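(* Let $\phi:G\to H$ be a homomorphism of (arbitrary, discrete) groups with kernel $K$. Then $$\operatorname{asdim} G\le \operatorname{asdim} H+\operatorname{asdim} K .$$
   Context: Asymptotic dimension of a metric space: a metric space $X$ has $\operatorname{asdim} X\le n$ if for every $d>0$ there are $R$ and $n+1$ families $\mathcal U_0,\dots,\mathcal U_n$ of subsets of $X$ whose union covers $X$, such that each $\mathcal U_i$ is $R$-bounded (every member has diameter at most $R$) and $d$-disjoint (the distance between $x\in U$ and $y\in V$ is $>d$ whenever $U\ne V$ are members of $\mathcal U_i$). $\operatorname{asdim}X$ is the least such $n$, or $\infty$ if none exists. A metric $d$ on a group is left invariant if $d(gx,gy)=d(x,y)$ for all $g,x,y$, and proper if all closed balls are compact. For a countable (discrete) group, $\operatorname{asdim}$ is the asymptotic dimension of the group with any proper left invariant metric (all closed balls finite); such a metric exists and the value does not depend on its choice. For a finitely generated group, the word metric of a finite generating set is such a metric. For an arbitrary group $G$, $\operatorname{asdim} G=\sup\{\operatorname{asdim} F\mid F\subset G \text{ a finitely generated subgroup}\}$ (this agrees with the previous definition when $G$ is countable). Values lie in $\{0,1,2,\dots\}\cup\{\infty\}$. *)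

theory Defs
  imports "HOL-Analysis.Abstract_Metric_Spaces" "HOL-Algebra.Generated_Groups"
    "HOL-Library.Extended_Nat"
begin

definition bounded_family :: "('a \<Rightarrow> 'a \<Rightarrow> real) \<Rightarrow> real \<Rightarrow> 'a set set \<Rightarrow> bool" where
  "bounded_family d R \<U> \<longleftrightarrow> (\<forall>U\<in>\<U>. \<forall>x\<in>U. \<forall>y\<in>U. d x y \<le> R)"

definition d_disjoint_family :: "('a \<Rightarrow> 'a \<Rightarrow> real) \<Rightarrow> real \<Rightarrow> 'a set set \<Rightarrow> bool" where
  "d_disjoint_family d D \<U> \<longleftrightarrow> (\<forall>U\<in>\<U>. \<forall>V\<in>\<U>. U \<noteq> V \<longrightarrow> (\<forall>x\<in>U. \<forall>y\<in>V. D < d x y))"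

definition asdim_le :: "'a set \<Rightarrow> ('a \<Rightarrow> 'a \<Rightarrow> real) \<Rightarrow> nat \<Rightarrow> bool" where
  "asdim_le X d n \<longleftrightarrow>
     (\<forall>D>0. \<exists>R. \<exists>\<U> :: nat \<Rightarrow> 'a set set.
        (\<Union>i\<le>n. \<Union>(\<U> i)) = X \<and>
        (\<forall>i\<le>n. bounded_family d R (\<U> i) \<and> d_disjoint_family d D (\<U> i)))"

text \<open>The infimum of the empty set in \<^typ>\<open>enat\<close> is \<^term>\<open>\<infinity>\<close>.\<close>

definition asdim :: "'a set \<Rightarrow> ('a \<Rightarrow> 'a \<Rightarrow> real) \<Rightarrow> enat" where
  "asdim X d = Inf {enat n | n. asdim_le X d n}"

text \<open>Properness is required in the form appropriate to discrete groups: closed balls are finite.\<close>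

definition proper_left_invariant_metric :: "('a, 'c) monoid_scheme \<Rightarrow> ('a \<Rightarrow> 'a \<Rightarrow> real) \<Rightarrow> bool" where
  "proper_left_invariant_metric G d \<longleftrightarrow>
     Metric_space (carrier G) d \<and>
     (\<forall>g\<in>carrier G. \<forall>x\<in>carrier G. \<forall>y\<in>carrier G. d (g \<otimes>\<^bsub>G\<^esub> x) (g \<otimes>\<^bsub>G\<^esub> y) = d x y) \<and>
     (\<forall>x\<in>carrier G. \<forall>r. finite (Metric_space.mcball (carrier G) d x r))"

text \<open>Only meaningful for countable groups. The choice of a metric is legitimate by the existence
  and independence lemmas below.\<close>

definition asdim_countable_group :: "('a, 'c) monoid_scheme \<Rightarrow> enat" where
  "asdim_countable_group G = asdim (carrier G) (SOME d. proper_left_invariant_metric G d)"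

definition finitely_generated_subgroup :: "'a set \<Rightarrow> ('a, 'c) monoid_scheme \<Rightarrow> bool" where
  "finitely_generated_subgroup F G \<longleftrightarrow>
     subgroup F G \<and> (\<exists>S. finite S \<and> S \<subseteq> carrier G \<and> generate G S = F)"

definition asdim_group :: "('a, 'c) monoid_scheme \<Rightarrow> enat" where
  "asdim_group G =
     (SUP F \<in> {F. finitely_generated_subgroup F G}. asdim_countable_group (G\<lparr>carrier := F\<rparr>))"

lemma asdim_le_proper_left_invariant:
  assumes "group G" "proper_left_invariant_metric G d" "proper_left_invariant_metric G d'"
    and le: "asdim_le (carrier G) d n"
  shows "asdim_le (carrier G) d' n"
proof -
  have control: "\<exists>r'>0. \<forall>x\<in>carrier G. \<forall>y\<in>carrier G. e x y \<le> r \<longrightarrow> e' x y \<le> r'"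
    if e: "proper_left_invariant_metric G e" and e': "proper_left_invariant_metric G e'"
    for e e' and r :: real
  proof -
    interpret group G by fact
    interpret e: Metric_space "carrier G" e
      using e by (simp add: proper_left_invariant_metric_def)
    let ?A = "e' \<one>\<^bsub>G\<^esub> ` e.mcball \<one>\<^bsub>G\<^esub> r"
    have "finite ?A"
      using e by (simp add: proper_left_invariant_metric_def)
    then obtain b where b: "\<And>a. a \<in> ?A \<Longrightarrow> a \<le> b"
      by (meson Max_ge)
    have "e' x y \<le> max b 1" if "x \<in> carrier G" "y \<in> carrier G" "e x y \<le> r" for x y
    proof -
      let ?z = "inv\<^bsub>G\<^esub> x \<otimes>\<^bsub>G\<^esub> y"
      have z: "?z \<in> carrier G" using that by simp
      have xz: "x \<otimes>\<^bsub>G\<^esub> ?z = y" using that by (simp add: m_assoc[symmetric])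
      have "e \<one>\<^bsub>G\<^esub> ?z = e (x \<otimes>\<^bsub>G\<^esub> \<one>\<^bsub>G\<^esub>) (x \<otimes>\<^bsub>G\<^esub> ?z)"
        using e z that unfolding proper_left_invariant_metric_def by (metis one_closed)
      moreover have "e' \<one>\<^bsub>G\<^esub> ?z = e' (x \<otimes>\<^bsub>G\<^esub> \<one>\<^bsub>G\<^esub>) (x \<otimes>\<^bsub>G\<^esub> ?z)"
        using e' z that unfolding proper_left_invariant_metric_def by (metis one_closed)
      ultimately have "e \<one>\<^bsub>G\<^esub> ?z = e x y" "e' \<one>\<^bsub>G\<^esub> ?z = e' x y"
        using that by (simp_all add: xz)
      then have "?z \<in> e.mcball \<one>\<^bsub>G\<^esub> r" using that z by simp
      then have "e' \<one>\<^bsub>G\<^esub> ?z \<in> ?A" by (rule imageI)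
      then have "e' x y \<in> ?A" unfolding \<open>e' \<one>\<^bsub>G\<^esub> ?z = e' x y\<close> .
      then show ?thesis using b by (simp add: le_max_iff_disj)
    qed
    then show ?thesis by (intro exI[of _ "max b 1"]) auto
  qed
  show ?thesis
    unfolding asdim_le_def
  proof (intro allI impI)
    fix D :: real assume "D > 0"
    obtain D' where D': "D' > 0" "\<forall>x\<in>carrier G. \<forall>y\<in>carrier G. d' x y \<le> D \<longrightarrow> d x y \<le> D'"
      using control[OF assms(3,2)] by blast
    obtain R \<U> where U: "(\<Union>i\<le>n. \<Union>(\<U> i)) = carrier G"
      "\<forall>i\<le>n. bounded_family d R (\<U> i) \<and> d_disjoint_family d D' (\<U> i)"
      using le[unfolded asdim_le_def, rule_format, OF D'(1)] by (elim exE conjE) rule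
    obtain R' where R': "\<forall>x\<in>carrier G. \<forall>y\<in>carrier G. d x y \<le> R \<longrightarrow> d' x y \<le> R'"
      using control[OF assms(2,3)] by blast
    have sub: "x \<in> carrier G" if "i \<le> n" "V \<in> \<U> i" "x \<in> V" for i V x
      using U(1) that by blast
    have "bounded_family d' R' (\<U> i)" if "i \<le> n" for i
      using U(2) R' sub[OF that] that unfolding bounded_family_def by blast
    moreover have "d_disjoint_family d' D (\<U> i)" if "i \<le> n" for i
      unfolding d_disjoint_family_def
    proof (intro ballI impI)
      fix V W x y assume h: "V \<in> \<U> i" "W \<in> \<U> i" "V \<noteq> W" "x \<in> V" "y \<in> W"
      then have "D' < d x y" using U(2) that unfolding d_disjoint_family_def by blast
      then show "D < d' x y"
        using D'(2) sub[OF that h(1,4)] sub[OF that h(2,5)] by (meson not_le)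
    qed
    ultimately show "\<exists>R \<U>. (\<Union>i\<le>n. \<Union>(\<U> i)) = carrier G \<and>
        (\<forall>i\<le>n. bounded_family d' R (\<U> i) \<and> d_disjoint_family d' D (\<U> i))"
      using U(1) by blast
  qed
qed

lemma exists_proper_left_invariant_metric:
  assumes "group G" "countable (carrier G)"
  shows "\<exists>d. proper_left_invariant_metric G d"
proof -
  interpret group G by fact
  define w :: "'a \<Rightarrow> nat" where "w = to_nat_on (carrier G)"
  define v where "v x = w x + w (inv\<^bsub>G\<^esub> x) + 1" for x
  define P where "P xs = foldr (\<otimes>\<^bsub>G\<^esub>) xs \<one>\<^bsub>G\<^esub>" for xs
  define L where "L g = (LEAST n. \<exists>xs. set xs \<subseteq> carrier G \<and> P xs = g \<and> sum_list (map v xs) = n)" for g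
  have Pc: "P xs \<in> carrier G" if "set xs \<subseteq> carrier G" for xs
    using that unfolding P_def by (induction xs) auto
  have Papp: "P (xs @ ys) = P xs \<otimes>\<^bsub>G\<^esub> P ys" if "set xs \<subseteq> carrier G" "set ys \<subseteq> carrier G" for xs ys
    using that Pc[OF that(2)] Pc unfolding P_def by (induction xs) (auto simp: m_assoc)
  have P1: "P [x] = x" if "x \<in> carrier G" for x
    using that by (simp add: P_def)
  have Prev: "P (rev (map (m_inv G) xs)) = inv\<^bsub>G\<^esub> (P xs)" if "set xs \<subseteq> carrier G" for xs
    using that
  proof (induction xs)
    case Nil
    then show ?case by (simp add: P_def)
  next
    case (Cons x xs)
    then have "P (rev (map (m_inv G) (x # xs))) = inv\<^bsub>G\<^esub> (P xs) \<otimes>\<^bsub>G\<^esub> inv\<^bsub>G\<^esub> x"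
      using Papp[of "rev (map (m_inv G) xs)" "[inv\<^bsub>G\<^esub> x]"] P1[of "inv\<^bsub>G\<^esub> x"] by auto
    also have "\<dots> = inv\<^bsub>G\<^esub> (x \<otimes>\<^bsub>G\<^esub> P xs)"
      using Cons.prems Pc[of xs] by (simp add: inv_mult_group)
    finally show ?case by (simp add: P_def)
  qed
  have Lle: "L (P xs) \<le> sum_list (map v xs)" if "set xs \<subseteq> carrier G" for xs
    unfolding L_def using that by (intro Least_le) blast
  have Lex: "\<exists>xs. set xs \<subseteq> carrier G \<and> P xs = g \<and> sum_list (map v xs) = L g"
    if "g \<in> carrier G" for g
  proof -
    have "set [g] \<subseteq> carrier G \<and> P [g] = g \<and> sum_list (map v [g]) = sum_list (map v [g])"
      using that P1 by simp
    then show ?thesis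
      unfolding L_def by - (rule LeastI, rule exI)
  qed
  have L0: "L g = 0 \<longleftrightarrow> g = \<one>\<^bsub>G\<^esub>" if g: "g \<in> carrier G" for g
  proof
    assume "L g = 0"
    then obtain xs where xs: "P xs = g" "sum_list (map v xs) = 0"
      using Lex[OF g] by auto
    then have "xs = []" by (cases xs) (auto simp: v_def)
    then show "g = \<one>\<^bsub>G\<^esub>" using xs by (simp add: P_def)
  next
    assume "g = \<one>\<^bsub>G\<^esub>"
    then show "L g = 0" using Lle[of "[]"] by (simp add: P_def)
  qed
  have Linv_le: "L (inv\<^bsub>G\<^esub> g) \<le> L g" if g: "g \<in> carrier G" for g
  proof -
    obtain xs where xs: "set xs \<subseteq> carrier G" "P xs = g" "sum_list (map v xs) = L g"
      using Lex[OF g] by blast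
    have "map v (map (m_inv G) xs) = map v xs"
      using xs(1) by (auto simp: v_def)
    then have "sum_list (map v (rev (map (m_inv G) xs))) = L g"
      using xs(3) by (metis rev_map sum_list_rev)
    moreover have "set (rev (map (m_inv G) xs)) \<subseteq> carrier G"
      using xs(1) by auto
    ultimately show ?thesis
      using Lle[of "rev (map (m_inv G) xs)"] Prev[OF xs(1)] xs(2) by simp
  qed
  have Linv: "L (inv\<^bsub>G\<^esub> g) = L g" if "g \<in> carrier G" for g
    using Linv_le[OF that] Linv_le[of "inv\<^bsub>G\<^esub> g"] that by simp
  have Lmult: "L (g \<otimes>\<^bsub>G\<^esub> h) \<le> L g + L h" if gh: "g \<in> carrier G" "h \<in> carrier G" for g h
  proof -
    obtain xs where "set xs \<subseteq> carrier G" "P xs = g" "sum_list (map v xs) = L g"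
      using Lex[OF gh(1)] by blast
    moreover obtain ys where "set ys \<subseteq> carrier G" "P ys = h" "sum_list (map v ys) = L h"
      using Lex[OF gh(2)] by blast
    ultimately show ?thesis using Lle[of "xs @ ys"] Papp[of xs ys] by simp
  qed
  have Lfin: "finite {g \<in> carrier G. L g \<le> n}" for n
  proof -
    let ?A = "{x \<in> carrier G. w x \<le> n}"
    have "finite (w ` ?A)" by (rule finite_subset[of _ "{..n}"]) auto
    moreover have "inj_on w ?A"
      using inj_on_to_nat_on[OF assms(2)] unfolding w_def by (rule inj_on_subset) auto
    ultimately have "finite ?A" by (rule finite_imageD)
    then have "finite {xs. set xs \<subseteq> ?A \<and> length xs \<le> n}"
      by (rule finite_lists_length_le)
    moreover have "{g \<in> carrier G. L g \<le> n} \<subseteq> P ` {xs. set xs \<subseteq> ?A \<and> length xs \<le> n}"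
    proof
      fix g assume g: "g \<in> {g \<in> carrier G. L g \<le> n}"
      then obtain xs where xs: "set xs \<subseteq> carrier G" "P xs = g" "sum_list (map v xs) \<le> n"
        using Lex[of g] by auto
      have "length ys \<le> sum_list (map v ys)" for ys
        by (induction ys) (auto simp: v_def)
      moreover have "w x \<le> sum_list (map v ys)" if "x \<in> set ys" for x ys
        using member_le_sum_list[of "v x" "map v ys"] that by (auto simp: v_def)
      ultimately have "set xs \<subseteq> ?A" "length xs \<le> n"
        using xs(1,3) by (auto intro: order_trans)
      then show "g \<in> P ` {xs. set xs \<subseteq> ?A \<and> length xs \<le> n}"
        using xs(2) by blast
    qed
    ultimately show ?thesis by (meson finite_surj)
  qed
  define d where "d x y = (if x \<in> carrier G \<and> y \<in> carrier G
      then real (L (inv\<^bsub>G\<^esub> x \<otimes>\<^bsub>G\<^esub> y)) else 0)" for x y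
  have tri: "inv\<^bsub>G\<^esub> x \<otimes>\<^bsub>G\<^esub> z = (inv\<^bsub>G\<^esub> x \<otimes>\<^bsub>G\<^esub> y) \<otimes>\<^bsub>G\<^esub> (inv\<^bsub>G\<^esub> y \<otimes>\<^bsub>G\<^esub> z)"
    if "x \<in> carrier G" "y \<in> carrier G" "z \<in> carrier G" for x y z
  proof -
    have "y \<otimes>\<^bsub>G\<^esub> (inv\<^bsub>G\<^esub> y \<otimes>\<^bsub>G\<^esub> z) = z"
      using that by (simp add: m_assoc[symmetric])
    then show ?thesis using that by (simp add: m_assoc)
  qed
  have sym: "L (inv\<^bsub>G\<^esub> x \<otimes>\<^bsub>G\<^esub> y) = L (inv\<^bsub>G\<^esub> y \<otimes>\<^bsub>G\<^esub> x)"
    if "x \<in> carrier G" "y \<in> carrier G" for x y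
    using Linv[of "inv\<^bsub>G\<^esub> y \<otimes>\<^bsub>G\<^esub> x"] that by (simp add: inv_mult_group)
  have dist0: "inv\<^bsub>G\<^esub> x \<otimes>\<^bsub>G\<^esub> y = \<one>\<^bsub>G\<^esub> \<longleftrightarrow> x = y" if "x \<in> carrier G" "y \<in> carrier G" for x y
    using that by (metis inv_closed inv_equality inv_inv l_inv)
  interpret d: Metric_space "carrier G" d
  proof
    fix x y z assume "x \<in> carrier G" "y \<in> carrier G" "z \<in> carrier G"
    then show "d x z \<le> d x y + d y z"
      using Lmult[of "inv\<^bsub>G\<^esub> x \<otimes>\<^bsub>G\<^esub> y" "inv\<^bsub>G\<^esub> y \<otimes>\<^bsub>G\<^esub> z"] tri[of x y z]
      by (simp add: d_def)
  qed (auto simp: d_def sym L0 dist0)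
  have "d (g \<otimes>\<^bsub>G\<^esub> x) (g \<otimes>\<^bsub>G\<^esub> y) = d x y"
    if "g \<in> carrier G" "x \<in> carrier G" "y \<in> carrier G" for g x y
  proof -
    have "inv\<^bsub>G\<^esub> g \<otimes>\<^bsub>G\<^esub> (g \<otimes>\<^bsub>G\<^esub> y) = y"
      using that by (simp add: m_assoc[symmetric])
    then show ?thesis
      using that by (simp add: d_def inv_mult_group m_assoc)
  qed
  moreover have "finite (d.mcball x r)" if x: "x \<in> carrier G" for x r
  proof -
    have "y \<in> (\<lambda>g. x \<otimes>\<^bsub>G\<^esub> g) ` {g \<in> carrier G. L g \<le> nat \<lceil>r\<rceil>}" if "y \<in> d.mcball x r" for y
    proof
      have y: "y \<in> carrier G" "d x y \<le> r" using that by auto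
      show "y = x \<otimes>\<^bsub>G\<^esub> (inv\<^bsub>G\<^esub> x \<otimes>\<^bsub>G\<^esub> y)"
        using x y by (simp add: m_assoc[symmetric])
      show "inv\<^bsub>G\<^esub> x \<otimes>\<^bsub>G\<^esub> y \<in> {g \<in> carrier G. L g \<le> nat \<lceil>r\<rceil>}"
        using x y by (simp add: d_def) linarith
    qed
    then show ?thesis using Lfin by (meson finite_surj subsetI)
  qed
  ultimately show ?thesis
    unfolding proper_left_invariant_metric_def using d.Metric_space_axioms by blast
qed

lemma asdim_countable_group_eq:
  assumes "group G" "proper_left_invariant_metric G d"
  shows "asdim_countable_group G = asdim (carrier G) d"
proof -
  have "proper_left_invariant_metric G (SOME d. proper_left_invariant_metric G d)"
    using assms(2) by (rule someI[of "proper_left_invariant_metric G" d])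
  then have "asdim_le (carrier G) (SOME d. proper_left_invariant_metric G d) n \<longleftrightarrow>
      asdim_le (carrier G) d n" for n
    using asdim_le_proper_left_invariant[OF assms(1)] assms(2) by blast
  then show ?thesis
    by (simp add: asdim_countable_group_def asdim_def)
qed

end

theory Submission
  imports Defs
begin

text \<open>
The inequality is a Hurewicz theorem for the projection of a finitely generated subgroup \<open>F\<close> of \<open>G\<close>
onto \<open>\<phi>(F)\<close>, whose fibres are cosets of \<open>F \<inter> K\<close>. The sets covering a metric space are handled through
their \<open>D\<close>-components, that is, the classes of points joined by chains with steps of length at most \<open>D\<close>:
\<open>asdim X \<le> n\<close> holds iff for each \<open>D\<close> the space is a union of \<open>n + 1\<close> sets whose \<open>D\<close>-components are
uniformly bounded.

Let \<open>n\<close> and \<open>m\<close> bound the dimensions of the base and of the fibres. The sum \<open>n + m\<close>, rather than the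
product bound that comes from combining \<open>n + 1\<close> sets of the base with \<open>m + 1\<close> sets of the fibres, is
due to an idea of Kolmogorov: more sets buy higher multiplicity. The base has a cover by
\<open>n + m + 1\<close> sets \<open>Q i\<close> such that each point lies in at least \<open>m + 1\<close> of them
(\<open>asdim_le_imp_multi_cover\<close>). So the fibre over \<open>y\<close>, which is covered by \<open>m + 1\<close> sets, can distribute
these sets injectively to the indices \<open>i\<close> with \<open>y \<in> Q i\<close>. The set with index \<open>i\<close> in the total space
collects what it receives from all fibres.

A \<open>D\<close>-chain inside the set with index \<open>i\<close> stays over one component of \<open>Q i\<close>, which is bounded, but the
pieces from the different fibres over this component may still connect to long chains. To prevent this, the fibres
are cut at different scales. In a group with a proper left invariant metric all balls of a given
radius have the same size, so the base has a colouring with finitely many colours in which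
distinct points of a component of \<open>Q i\<close> have distinct colours (\<open>ex_separating_colouring\<close>). The fibre over \<open>y\<close> is cut at
a scale given by the colour of \<open>y\<close>, and each scale exceeds the size of the components formed by all earlier
colours. Then a union lemma (\<open>bounded_components_Un\<close>), applied once per colour, bounds
the components of the union. This is \<open>asdim_le_fibration\<close>.

The kernel of the restriction to \<open>F\<close> need not be finitely generated, whereas the dimension of \<open>K\<close> is
defined by the finitely generated subgroups. They suffice at each single scale: the
elements of length at most \<open>D\<close> generate a subgroup whose cosets lie at mutual distance more than \<open>D\<close>, so a cover of
this subgroup can be translated to all cosets at once (\<open>asdim_le_subgroup\<close>).
\<close>

section \<open>Bounded components at a given scale\<close>

definition linked :: "('a \<Rightarrow> 'a \<Rightarrow> real) \<Rightarrow> real \<Rightarrow> 'a set \<Rightarrow> 'a \<Rightarrow> 'a \<Rightarrow> bool" where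
  "linked d D A x y \<longleftrightarrow> x \<in> A \<and> y \<in> A \<and> d x y \<le> D"

abbreviation chained :: "('a \<Rightarrow> 'a \<Rightarrow> real) \<Rightarrow> real \<Rightarrow> 'a set \<Rightarrow> 'a \<Rightarrow> 'a \<Rightarrow> bool" where
  "chained d D A \<equiv> (linked d D A)\<^sup>*\<^sup>*"

text \<open>Working with components instead of families of pieces has the advantage that a bound on the components passes
to subsets and that no choice of a family has to be carried along.\<close>

definition bounded_components :: "('a \<Rightarrow> 'a \<Rightarrow> real) \<Rightarrow> real \<Rightarrow> real \<Rightarrow> 'a set \<Rightarrow> bool" where
  "bounded_components d D R A \<longleftrightarrow> (\<forall>x\<in>A. \<forall>y. chained d D A x y \<longrightarrow> d x y \<le> R)"

lemma bounded_componentsI: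
  assumes refl: "\<And>x. x \<in> A \<Longrightarrow> E x x"
    and step: "\<And>x y z. \<lbrakk>x \<in> A; y \<in> A; z \<in> A; E x y; d y z \<le> D\<rbrakk> \<Longrightarrow> E x z"
    and bounded: "\<And>x y. \<lbrakk>x \<in> A; y \<in> A; E x y\<rbrakk> \<Longrightarrow> d x y \<le> R"
  shows "bounded_components d D R A"
  unfolding bounded_components_def
proof (intro ballI allI impI)
  fix x y assume x: "x \<in> A" and xy: "chained d D A x y"
  from xy have "y \<in> A \<and> E x y"
  proof induction
    case base
    show ?case using x refl by blast
  next
    case (step y z)
    then show ?case using x assms(2)[of x y z] by (auto simp: linked_def)
  qed
  then show "d x y \<le> R" using x bounded by blast
qed

lemma bounded_componentsD:
  "bounded_components d D R A \<Longrightarrow> x \<in> A \<Longrightarrow> chained d D A x y \<Longrightarrow> d x y \<le> R"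
  by (auto simp: bounded_components_def)

lemma chained_in: "chained d D A x y \<Longrightarrow> x \<in> A \<Longrightarrow> y \<in> A"
  by (induction rule: rtranclp_induct) (auto simp: linked_def)

lemma chained_step:
  "chained d D A x y \<Longrightarrow> y \<in> A \<Longrightarrow> z \<in> A \<Longrightarrow> d y z \<le> D \<Longrightarrow> chained d D A x z"
  by (erule rtranclp.rtrancl_into_rtrancl) (simp add: linked_def)

lemma (in Metric_space) chained_sym: "chained d D A x y \<Longrightarrow> chained d D A y x"
  by (rule sympD[OF symp_rtranclp]) (auto simp: symp_def linked_def commute)

lemma chained_mono:
  assumes "D \<le> D'" "chained d D A x y" shows "chained d D' A x y"
proof -
  have "linked d D A \<le> linked d D' A" using assms(1) by (auto simp: linked_def)
  from rtranclp_mono[OF this] show ?thesis using assms(2) by blast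
qed

lemma bounded_components_mono:
  "\<lbrakk>bounded_components d D R A; D' \<le> D; R \<le> R'\<rbrakk> \<Longrightarrow> bounded_components d D' R' A"
  unfolding bounded_components_def
  by (intro ballI allI impI) (blast intro: order_trans[of _ R R'] dest: chained_mono[of D' D])

text \<open>A map that changes distances by at most \<open>c\<close> turns \<open>D\<close>-chains into \<open>(D + c)\<close>-chains.\<close>

lemma bounded_components_vimage:
  assumes A: "bounded_components e (D + c) R A"
    and q: "\<And>x y. \<lbrakk>x \<in> X; y \<in> X\<rbrakk> \<Longrightarrow> \<bar>e (q x) (q y) - d x y\<bar> \<le> c"
  shows "bounded_components d D (R + c) {x\<in>X. q x \<in> A}"
proof (rule bounded_componentsI[where E = "\<lambda>x y. chained e (D + c) A (q x) (q y)"])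
  fix x y z assume h: "x \<in> {x \<in> X. q x \<in> A}" "y \<in> {x \<in> X. q x \<in> A}" "z \<in> {x \<in> X. q x \<in> A}"
    "chained e (D + c) A (q x) (q y)" "d y z \<le> D"
  have "e (q y) (q z) \<le> D + c" using q[of y z] h by (simp add: abs_le_iff)
  with h show "chained e (D + c) A (q x) (q z)" using chained_step[of e "D + c" A "q x" "q y" "q z"] by simp
next
  fix x y assume h: "x \<in> {x \<in> X. q x \<in> A}" "y \<in> {x \<in> X. q x \<in> A}"
    "chained e (D + c) A (q x) (q y)"
  then have "e (q x) (q y) \<le> R" using bounded_componentsD[OF A] by auto
  then show "d x y \<le> R + c" using q[of x y] h by (simp add: abs_le_iff)
qed auto

text \<open>The indices are arranged such that a space of dimension at most \<open>n\<close> has these covers for every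
multiplicity \<open>k\<close>: one extra set for each extra unit of multiplicity.\<close>

definition multi_cover :: "('a \<Rightarrow> 'a \<Rightarrow> real) \<Rightarrow> real \<Rightarrow> real \<Rightarrow> nat \<Rightarrow> nat \<Rightarrow> 'a set \<Rightarrow> bool" where
  "multi_cover d D R n k X \<longleftrightarrow> (\<exists>A :: nat \<Rightarrow> 'a set.
     (\<forall>i<n + k. A i \<subseteq> X \<and> bounded_components d D R (A i)) \<and>
     (\<forall>x\<in>X. k \<le> card {i. i < n + k \<and> x \<in> A i}))"

lemma multi_coverE:
  assumes "multi_cover d D R n k X"
  obtains A where "\<And>i. i < n + k \<Longrightarrow> A i \<subseteq> X"
    "\<And>i. i < n + k \<Longrightarrow> bounded_components d D R (A i)"
    "\<And>x. x \<in> X \<Longrightarrow> k \<le> card {i. i < n + k \<and> x \<in> A i}"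
proof -
  obtain A where "(\<forall>i<n + k. A i \<subseteq> X \<and> bounded_components d D R (A i)) \<and>
     (\<forall>x\<in>X. k \<le> card {i. i < n + k \<and> x \<in> A i})"
    using assms unfolding multi_cover_def by (rule exE)
  then show thesis by (intro that[of A]) simp_all
qed

lemma multi_cover_vimage:
  assumes "multi_cover e (D + c) R n k Z" and "q ` X \<subseteq> Z"
    and "\<And>x y. \<lbrakk>x \<in> X; y \<in> X\<rbrakk> \<Longrightarrow> \<bar>e (q x) (q y) - d x y\<bar> \<le> c"
  shows "multi_cover d D (R + c) n k X"
proof -
  obtain A where "\<And>i. i < n + k \<Longrightarrow> A i \<subseteq> Z"
    and A: "\<And>i. i < n + k \<Longrightarrow> bounded_components e (D + c) R (A i)"
    "\<And>z. z \<in> Z \<Longrightarrow> k \<le> card {i. i < n + k \<and> z \<in> A i}"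
    by (rule multi_coverE[OF assms(1)]) (rule that)
  show ?thesis
    unfolding multi_cover_def
  proof (intro exI[of _ "\<lambda>i. {x\<in>X. q x \<in> A i}"] conjI allI impI ballI)
    fix i assume i: "i < n + k"
    show "bounded_components d D (R + c) {x\<in>X. q x \<in> A i}"
      by (rule bounded_components_vimage[OF A(1)[OF i]]) (rule assms(3))
  next
    fix x assume x: "x \<in> X"
    then have "q x \<in> Z" using assms(2) by blast
    from A(2)[OF this] show "k \<le> card {i. i < n + k \<and> x \<in> {x\<in>X. q x \<in> A i}}"
      using x by simp
  qed auto
qed

lemma multi_cover_1_iff:
  "multi_cover d D R n 1 X \<longleftrightarrow> (\<exists>A. (\<forall>i\<le>n. A i \<subseteq> X \<and> bounded_components d D R (A i)) \<and>
     (\<forall>x\<in>X. \<exists>i\<le>n. x \<in> A i))"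
proof -
  have "1 \<le> card {i. i < n + 1 \<and> P i} \<longleftrightarrow> {i. i < n + 1 \<and> P i} \<noteq> {}" for P
    by (simp add: Suc_le_eq card_gt_0_iff)
  then have "1 \<le> card {i. i < n + 1 \<and> P i} \<longleftrightarrow> (\<exists>i\<le>n. P i)" for P
    by (auto simp: less_Suc_eq_le)
  then show ?thesis unfolding multi_cover_def by (simp add: less_Suc_eq_le)
qed

text \<open>The components of a \<open>D\<close>-disjoint family with bounded members lie inside the members. Conversely, distinct
\<open>D\<close>-components of a set are \<open>D\<close>-disjoint.\<close>

lemma (in Metric_space) asdim_le_iff_multi_cover:
  assumes "X \<subseteq> M"
  shows "asdim_le X d n \<longleftrightarrow> (\<forall>D>0. \<exists>R. multi_cover d D R n 1 X)"
proof
  assume L: "asdim_le X d n"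
  show "\<forall>D>0. \<exists>R. multi_cover d D R n 1 X"
  proof (intro allI impI)
    fix D :: real assume D: "D > 0"
    obtain R \<U> where U: "(\<Union>i\<le>n. \<Union>(\<U> i)) = X"
      "\<And>i. i \<le> n \<Longrightarrow> bounded_family d R (\<U> i)" "\<And>i. i \<le> n \<Longrightarrow> d_disjoint_family d D (\<U> i)"
      using L[unfolded asdim_le_def, rule_format, OF D] by (elim exE conjE) blast
    have "multi_cover d D R n 1 X"
      unfolding multi_cover_1_iff
    proof (intro exI[of _ "\<lambda>i. \<Union>(\<U> i)"] conjI allI impI ballI)
      fix i assume i: "i \<le> n"
      show "bounded_components d D R (\<Union>(\<U> i))"
      proof (rule bounded_componentsI[where E = "\<lambda>x y. \<exists>V\<in>\<U> i. x \<in> V \<and> y \<in> V"])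
        fix x y z assume z: "z \<in> \<Union>(\<U> i)" and xy: "\<exists>V\<in>\<U> i. x \<in> V \<and> y \<in> V"
          and yz: "d y z \<le> D"
        obtain V where V: "V \<in> \<U> i" "x \<in> V" "y \<in> V" using xy by blast
        obtain W where W: "W \<in> \<U> i" "z \<in> W" using z by blast
        have "d_disjoint_family d D (\<U> i)" using U(3) i by simp
        then have "V = W"
          using V W yz unfolding d_disjoint_family_def by (meson not_le)
        then show "\<exists>V\<in>\<U> i. x \<in> V \<and> z \<in> V" using V W by blast
      qed (use U(2)[of i] i in \<open>auto simp: bounded_family_def\<close>)
      show "\<Union>(\<U> i) \<subseteq> X" unfolding U(1)[symmetric] using i by force
    next
      fix x assume "x \<in> X"
      then show "\<exists>i\<le>n. x \<in> \<Union>(\<U> i)" unfolding U(1)[symmetric] by blast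
    qed
    then show "\<exists>R. multi_cover d D R n 1 X" by blast
  qed
next
  assume L: "\<forall>D>0. \<exists>R. multi_cover d D R n 1 X"
  show "asdim_le X d n"
    unfolding asdim_le_def
  proof (intro allI impI)
    fix D :: real assume D: "D > 0"
    obtain R where "multi_cover d D R n 1 X" using L D by blast
    then obtain A where A0: "(\<forall>i\<le>n. A i \<subseteq> X \<and> bounded_components d D R (A i)) \<and>
        (\<forall>x\<in>X. \<exists>i\<le>n. x \<in> A i)"
      unfolding multi_cover_1_iff by (rule exE)
    then have A: "\<And>i. i \<le> n \<Longrightarrow> A i \<subseteq> X" "\<And>i. i \<le> n \<Longrightarrow> bounded_components d D R (A i)"
      "\<And>x. x \<in> X \<Longrightarrow> \<exists>i\<le>n. x \<in> A i"
      by simp_all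
    define \<U> where "\<U> i = (\<lambda>x. Collect (chained d D (A i) x)) ` A i" for i
    have sub: "\<Union>(\<U> i) = A i" for i
      unfolding \<U>_def using chained_in by fast
    have "bounded_family d R (\<U> i)" if i: "i \<le> n" for i
      unfolding bounded_family_def \<U>_def
    proof (clarify)
      fix a x y assume h: "a \<in> A i" "chained d D (A i) a x" "chained d D (A i) a y"
      have "chained d D (A i) x y" using chained_sym[OF h(2)] h(3) by simp
      then show "d x y \<le> R"
        using bounded_componentsD[OF A(2)[OF i]] chained_in[OF h(2,1)] by blast
    qed
    moreover have "d_disjoint_family d D (\<U> i)" for i
      unfolding d_disjoint_family_def \<U>_def
    proof (clarify, rule ccontr)
      fix a b x y assume h: "a \<in> A i" "b \<in> A i" "chained d D (A i) a x" "chained d D (A i) b y"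
        and ne: "Collect (chained d D (A i) a) \<noteq> Collect (chained d D (A i) b)" "\<not> D < d x y"
      have "chained d D (A i) a y"
        using chained_step[OF h(3) chained_in[OF h(3,1)] chained_in[OF h(4,2)]] ne(2) by simp
      then have ab: "chained d D (A i) a b" using chained_sym[OF h(4)] by simp
      then have "chained d D (A i) b a" by (rule chained_sym)
      with ab have "Collect (chained d D (A i) a) = Collect (chained d D (A i) b)"
        by (auto intro: rtranclp_trans)
      then show False using ne(1) by blast
    qed
    moreover have "(\<Union>i\<le>n. \<Union>(\<U> i)) = X"
      unfolding sub using A(1,3) by blast
    ultimately show "\<exists>R \<U>. (\<Union>i\<le>n. \<Union>(\<U> i)) = X \<and>
        (\<forall>i\<le>n. bounded_family d R (\<U> i) \<and> d_disjoint_family d D (\<U> i))"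
      by blast
  qed
qed

lemma asdim_le_mono:
  assumes "asdim_le X d n" "n \<le> n'" shows "asdim_le X d n'"
  unfolding asdim_le_def
proof (intro allI impI)
  fix D :: real assume D: "0 < D"
  obtain R \<U> where U: "(\<Union>i\<le>n. \<Union>(\<U> i)) = X"
    "\<forall>i\<le>n. bounded_family d R (\<U> i) \<and> d_disjoint_family d D (\<U> i)"
    using assms(1)[unfolded asdim_le_def, rule_format, OF D] by (elim exE conjE) (rule that)
  let ?\<U> = "\<lambda>i. if i \<le> n then \<U> i else {}"
  have "(\<Union>i\<le>n'. \<Union>(?\<U> i)) = (\<Union>i\<le>n. \<Union>(\<U> i))"
  proof (intro equalityI subsetI)
    fix x assume "x \<in> (\<Union>i\<le>n. \<Union>(\<U> i))"
    then obtain i V where "i \<le> n" "V \<in> \<U> i" "x \<in> V" by blast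
    then show "x \<in> (\<Union>i\<le>n'. \<Union>(?\<U> i))"
      using \<open>n \<le> n'\<close> by (intro UN_I[of i]) auto
  qed (auto split: if_splits)
  moreover have "bounded_family d R (?\<U> i) \<and> d_disjoint_family d D (?\<U> i)" for i
    using U(2) by (auto simp: bounded_family_def d_disjoint_family_def)
  ultimately show "\<exists>R \<U>. (\<Union>i\<le>n'. \<Union>(\<U> i)) = X \<and>
      (\<forall>i\<le>n'. bounded_family d R (\<U> i) \<and> d_disjoint_family d D (\<U> i))"
    using U(1) by (intro exI[of _ R] exI[of _ ?\<U>]) simp
qed

lemma asdim_le_enat_iff: "asdim X d \<le> enat n \<longleftrightarrow> asdim_le X d n"
proof
  assume "asdim X d \<le> enat n"
  also have "enat n < enat (Suc n)" by simp
  finally have "\<exists>a\<in>{enat k |k. asdim_le X d k}. a < enat (Suc n)"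
    unfolding asdim_def Inf_less_iff .
  then obtain k where "asdim_le X d k" "k < Suc n" by auto
  then show "asdim_le X d n" by (intro asdim_le_mono[of X d k n]) auto
next
  assume "asdim_le X d n"
  then show "asdim X d \<le> enat n" unfolding asdim_def by (intro Inf_lower) blast
qed

section \<open>Covers of higher multiplicity\<close>

text \<open>Each set \<open>A i\<close> is enlarged to its neighbourhood \<open>N i\<close> of radius \<open>D\<close>; chains in \<open>N i\<close> are shadowed by
chains in \<open>A i\<close> with steps of length \<open>3 * D\<close>. The points whose multiplicity is still only \<open>k\<close> form the
additional set \<open>B\<close>. The components of \<open>B\<close> are bounded for the following reason. For \<open>x \<in> B\<close> the \<open>k\<close> neighbourhoods
that contain \<open>x\<close> are those of the sets \<open>A i\<close> that contain \<open>x\<close>; a point of \<open>B\<close> at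
distance at most \<open>D\<close> lies in the same neighbourhoods, hence in no others, so a chain in \<open>B\<close> remains in a
fixed \<open>A i\<close>.\<close>

lemma (in Metric_space) multi_cover_Suc:
  assumes cover: "multi_cover d (3 * D) R n k X" and "X \<subseteq> M" "0 < k" "0 < D"
  shows "multi_cover d D (R + 2 * D) n (Suc k) X"
proof -
  obtain A where A: "\<And>i. i < n + k \<Longrightarrow> A i \<subseteq> X"
    "\<And>i. i < n + k \<Longrightarrow> bounded_components d (3 * D) R (A i)"
    "\<And>x. x \<in> X \<Longrightarrow> k \<le> card {i. i < n + k \<and> x \<in> A i}"
    by (rule multi_coverE[OF cover]) (rule that)
  define N where "N i = {x\<in>X. \<exists>a\<in>A i. d x a \<le> D}" for i
  define S where "S x = {i. i < n + k \<and> x \<in> N i}" for x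
  define B where "B = {x\<in>X. card (S x) = k}"
  define A' where "A' i = (if i < n + k then N i else B)" for i
  have fin: "finite (S x)" for x unfolding S_def by simp
  have AN: "A i \<subseteq> N i" if "i < n + k" for i
    using A(1)[OF that] \<open>X \<subseteq> M\<close> \<open>0 < D\<close> unfolding N_def by force
  have sub: "{i. i < n + k \<and> x \<in> A i} \<subseteq> S x" for x
    unfolding S_def using AN by blast
  have k_le: "k \<le> card (S x)" if "x \<in> X" for x
    using A(3)[OF that] card_mono[OF fin sub] by (rule order_trans)
  have SB: "S x = {i. i < n + k \<and> x \<in> A i}" if "x \<in> B" for x
    using card_subset_eq[OF fin sub] A(3)[of x] card_mono[OF fin sub, of x] that
    unfolding B_def by auto
  have "bounded_components d D (R + 2 * D) (N i)" if i: "i < n + k" for i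
  \<comment> \<open>The witnesses \<open>a\<close> and \<open>b\<close> are the ends of the shadowing chain.\<close>
  proof (rule bounded_componentsI[where E = "\<lambda>x y. \<exists>a\<in>A i. \<exists>b\<in>A i.
        d x a \<le> D \<and> d y b \<le> D \<and> chained d (3 * D) (A i) a b"])
    fix x assume "x \<in> N i"
    then show "\<exists>a\<in>A i. \<exists>b\<in>A i. d x a \<le> D \<and> d x b \<le> D \<and> chained d (3 * D) (A i) a b"
      unfolding N_def by blast
  next
    fix x y z assume h: "x \<in> N i" "y \<in> N i" "z \<in> N i" "d y z \<le> D"
      "\<exists>a\<in>A i. \<exists>b\<in>A i. d x a \<le> D \<and> d y b \<le> D \<and> chained d (3 * D) (A i) a b"
    then obtain a b where ab: "a \<in> A i" "b \<in> A i" "d x a \<le> D" "d y b \<le> D"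
      "chained d (3 * D) (A i) a b" by blast
    obtain c where c: "c \<in> A i" "d z c \<le> D" using h(3) unfolding N_def by blast
    have M: "y \<in> M" "z \<in> M" "b \<in> M" "c \<in> M"
      using h ab(2) c(1) A(1)[OF i] \<open>X \<subseteq> M\<close> unfolding N_def by auto
    have "d b c \<le> 3 * D"
      using triangle[of b y c] triangle[of y z c] M ab(4) c(2) h(4) commute[of b y] by simp
    then show "\<exists>a\<in>A i. \<exists>b\<in>A i. d x a \<le> D \<and> d z b \<le> D \<and> chained d (3 * D) (A i) a b"
      using ab c chained_step[OF ab(5)] by blast
  next
    fix x y assume h: "x \<in> N i" "y \<in> N i"
      "\<exists>a\<in>A i. \<exists>b\<in>A i. d x a \<le> D \<and> d y b \<le> D \<and> chained d (3 * D) (A i) a b"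
    then obtain a b where ab: "a \<in> A i" "b \<in> A i" "d x a \<le> D" "d y b \<le> D"
      "chained d (3 * D) (A i) a b" by blast
    have M: "x \<in> M" "y \<in> M" "a \<in> M" "b \<in> M"
      using h ab(1,2) A(1)[OF i] \<open>X \<subseteq> M\<close> unfolding N_def by auto
    show "d x y \<le> R + 2 * D"
      using triangle[of x a y] triangle[of a b y] M ab(3,4)
        bounded_componentsD[OF A(2)[OF i] ab(1,5)] commute[of b y] by simp
  qed
  moreover have "bounded_components d D (R + 2 * D) B"
  proof (rule bounded_componentsI[where E = "\<lambda>x y. S x = S y \<and>
        (\<forall>i\<in>S x. chained d (3 * D) (A i) x y)"])
    fix x y z assume h: "x \<in> B" "y \<in> B" "z \<in> B" "d y z \<le> D"
      "S x = S y \<and> (\<forall>i\<in>S x. chained d (3 * D) (A i) x y)"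
    \<comment> \<open>One step in \<open>B\<close> does not lose any index, and by cardinality it does not gain any.\<close>
    have "S y \<subseteq> S z"
      using h unfolding SB[OF h(2)] by (auto simp: S_def N_def B_def commute)
    then have "S y = S z"
      using card_subset_eq[OF fin] h(2,3) unfolding B_def by auto
    moreover have "chained d (3 * D) (A i) x z" if "i \<in> S y" for i
    proof (rule chained_step)
      show "chained d (3 * D) (A i) x y" using h(5) that by auto
      show "y \<in> A i" using that SB[OF h(2)] by blast
      show "z \<in> A i" using that \<open>S y = S z\<close> SB[OF h(3)] by blast
      show "d y z \<le> 3 * D" using h(4) \<open>0 < D\<close> by simp
    qed
    ultimately show "S x = S z \<and> (\<forall>i\<in>S x. chained d (3 * D) (A i) x z)"
      using h(5) by auto
  next
    fix x y assume h: "x \<in> B" "y \<in> B" "S x = S y \<and> (\<forall>i\<in>S x. chained d (3 * D) (A i) x y)"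
    have "S x \<noteq> {}" using h(1) \<open>0 < k\<close> unfolding B_def by auto
    then obtain i where "i \<in> S x" by blast
    then have "d x y \<le> R"
      using h(3) SB[OF h(1)] A(2)[of i] bounded_componentsD by fastforce
    then show "d x y \<le> R + 2 * D" using \<open>0 < D\<close> by simp
  qed auto
  ultimately have "A' i \<subseteq> X \<and> bounded_components d D (R + 2 * D) (A' i)" for i
    unfolding A'_def by (auto simp: N_def B_def)
  moreover have "Suc k \<le> card {i. i < n + Suc k \<and> x \<in> A' i}" if x: "x \<in> X" for x
  proof (cases "x \<in> B")
    case True
    have "insert (n + k) (S x) \<subseteq> {i. i < n + Suc k \<and> x \<in> A' i}"
      using True by (auto simp: S_def A'_def)
    then have "card (insert (n + k) (S x)) \<le> card {i. i < n + Suc k \<and> x \<in> A' i}"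
      by (rule card_mono[rotated]) simp
    moreover have "n + k \<notin> S x" unfolding S_def by simp
    ultimately show ?thesis using fin True by (simp add: B_def)
  next
    case False
    have "S x \<subseteq> {i. i < n + Suc k \<and> x \<in> A' i}"
      by (auto simp: S_def A'_def)
    then have "card (S x) \<le> card {i. i < n + Suc k \<and> x \<in> A' i}"
      by (rule card_mono[rotated]) simp
    then show ?thesis using k_le[OF x] False x by (simp add: B_def)
  qed
  ultimately show ?thesis unfolding multi_cover_def by blast
qed

lemma (in Metric_space) asdim_le_imp_multi_cover:
  assumes "asdim_le X d n" and "X \<subseteq> M" and "0 < D"
  shows "\<exists>R. multi_cover d D R n (Suc k) X"
  using \<open>0 < D\<close>
proof (induction k arbitrary: D)
  case 0
  then show ?case using assms by (simp add: asdim_le_iff_multi_cover)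
next
  case (Suc k)
  then obtain R where "multi_cover d (3 * D) R n (Suc k) X"
    by (meson mult_pos_pos zero_less_numeral)
  then show ?case using multi_cover_Suc assms(2) Suc.prems by blast
qed

section \<open>Unions of sets at increasing scales\<close>

lemma bounded_components_subset:
  assumes "bounded_components d D R B" "A \<subseteq> B"
  shows "bounded_components d D R A"
proof (rule bounded_componentsI[where E = "chained d D B"])
  fix x y z assume "y \<in> A" "z \<in> A" "chained d D B x y" "d y z \<le> D"
  then show "chained d D B x z" using assms(2) chained_step[of d D B x y z] by blast
next
  fix x y assume "x \<in> A" "chained d D B x y"
  then show "d x y \<le> R" using bounded_componentsD[OF assms(1)] assms(2) by blast
qed simp

text \<open>A \<open>D\<close>-chain in \<open>A \<union> B\<close> visits \<open>B\<close> from time to time. Between two visits it runs inside one component of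
\<open>A\<close>, so the two visits are within \<open>\<rho> + 2 * D\<close> of each other. At
this scale the components of \<open>B\<close> have size at most \<open>R\<close>, and the ends of the chain add at most \<open>\<rho> + D\<close> each.\<close>

lemma (in Metric_space) bounded_components_Un:
  assumes A: "bounded_components d D \<rho> A" and B: "bounded_components d (\<rho> + 2 * D) R B"
    and "A \<subseteq> M" "B \<subseteq> M" "0 \<le> D" "0 \<le> \<rho>" "0 \<le> R"
  shows "bounded_components d D (R + 2 * \<rho> + 2 * D) (A \<union> B)"
proof -
  \<comment> \<open>\<open>near x b\<close>: the point \<open>b\<close> of \<open>B\<close> is reached from \<open>x\<close> by a chain in \<open>A\<close> and one final step.\<close>
  define near where "near x b \<longleftrightarrow> x = b \<or> (\<exists>a\<in>A. chained d D A a x \<and> d a b \<le> D)" for x b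
  have near_dist: "d x b \<le> \<rho> + D" if "near x b" "x \<in> M" "b \<in> M" for x b
    using that(1) unfolding near_def
  proof (elim disjE bexE conjE)
    fix a assume a: "a \<in> A" "chained d D A a x" "d a b \<le> D"
    have "d a x \<le> \<rho>" using bounded_componentsD[OF A a(1,2)] .
    moreover have "a \<in> M" using a(1) \<open>A \<subseteq> M\<close> by blast
    ultimately show ?thesis using triangle[of x a b] that(2,3) a(3) commute[of a x] by linarith
  qed (use that \<open>0 \<le> \<rho>\<close> \<open>0 \<le> D\<close> in simp)
  show ?thesis
  \<comment> \<open>Either \<open>B\<close> has not been visited yet, or \<open>b\<close> and \<open>b'\<close> are the first and the latest visit.\<close>
  proof (rule bounded_componentsI[where E = "\<lambda>x y. x \<in> A \<and> chained d D A x y \<or>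
        (\<exists>b\<in>B. \<exists>b'\<in>B. near x b \<and> near y b' \<and> chained d (\<rho> + 2 * D) B b b')"])
    fix x assume "x \<in> A \<union> B"
    then show "x \<in> A \<and> chained d D A x x \<or>
        (\<exists>b\<in>B. \<exists>b'\<in>B. near x b \<and> near x b' \<and> chained d (\<rho> + 2 * D) B b b')"
      unfolding near_def by blast
  next
    fix x y z assume yz: "y \<in> A \<union> B" "z \<in> A \<union> B" "d y z \<le> D"
    assume "x \<in> A \<and> chained d D A x y \<or>
        (\<exists>b\<in>B. \<exists>b'\<in>B. near x b \<and> near y b' \<and> chained d (\<rho> + 2 * D) B b b')"
    then show "x \<in> A \<and> chained d D A x z \<or>
        (\<exists>b\<in>B. \<exists>b'\<in>B. near x b \<and> near z b' \<and> chained d (\<rho> + 2 * D) B b b')"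
    proof (elim disjE bexE conjE)
      assume h: "x \<in> A" "chained d D A x y"
      have y: "y \<in> A" using chained_in[OF h(2,1)] .
      have "near x z" if "z \<in> B"
        unfolding near_def using y yz(3) chained_sym[OF h(2)] by blast
      moreover have "near z z" unfolding near_def by simp
      moreover have "chained d D A x z" if "z \<in> A"
        using chained_step[OF h(2) y that yz(3)] .
      ultimately show ?thesis using h yz(2) by blast
    next
      fix b b' assume h: "b \<in> B" "b' \<in> B" "near x b" "near y b'" "chained d (\<rho> + 2 * D) B b b'"
      show ?thesis
      proof (cases "z \<in> B")
        case True
        have M: "y \<in> M" "z \<in> M" "b' \<in> M" using yz h \<open>A \<subseteq> M\<close> \<open>B \<subseteq> M\<close> by auto
        then have "d b' z \<le> \<rho> + 2 * D"
          using triangle[of b' y z] near_dist[OF h(4)] yz(3) commute[of y b'] by simp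
        then have "chained d (\<rho> + 2 * D) B b z" using chained_step[OF h(5,2) True] by blast
        moreover have "near z z" unfolding near_def by simp
        ultimately show ?thesis using h True by blast
      next
        case False
        then have z: "z \<in> A" using yz by blast
        have "near z b'"
          using h(4) unfolding near_def
        proof (elim disjE bexE conjE)
          assume "y = b'"
          then show "z = b' \<or> (\<exists>a\<in>A. chained d D A a z \<and> d a b' \<le> D)"
            using z yz(3) commute[of y z] by auto
        next
          fix a assume a: "a \<in> A" "chained d D A a y" "d a b' \<le> D"
          then have "chained d D A a z"
            using chained_step[OF a(2) chained_in[OF a(2,1)] z yz(3)] by blast
          then show "z = b' \<or> (\<exists>a\<in>A. chained d D A a z \<and> d a b' \<le> D)" using a by blast
        qed
        then show ?thesis using h by blast
      qed
    qed
  next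
    fix x y assume xy: "x \<in> A \<union> B" "y \<in> A \<union> B"
    assume "x \<in> A \<and> chained d D A x y \<or>
        (\<exists>b\<in>B. \<exists>b'\<in>B. near x b \<and> near y b' \<and> chained d (\<rho> + 2 * D) B b b')"
    then show "d x y \<le> R + 2 * \<rho> + 2 * D"
    proof (elim disjE bexE conjE)
      assume "x \<in> A" "chained d D A x y"
      then have "d x y \<le> \<rho>" by (rule bounded_componentsD[OF A])
      then show ?thesis using assms(5-7) by simp
    next
      fix b b' assume h: "b \<in> B" "b' \<in> B" "near x b" "near y b'" "chained d (\<rho> + 2 * D) B b b'"
      have M: "x \<in> M" "y \<in> M" "b \<in> M" "b' \<in> M" using xy h \<open>A \<subseteq> M\<close> \<open>B \<subseteq> M\<close> by auto
      have "d b b' \<le> R" using bounded_componentsD[OF B h(1,5)] .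
      then show ?thesis
        using triangle[of x b y] triangle[of b b' y] near_dist[OF h(3)] near_dist[OF h(4)] M
          commute[of y b'] by simp
    qed
  qed
qed

section \<open>A Hurewicz theorem for asymptotic dimension\<close>

text \<open>Greedy colouring of a countable graph of bounded degree: a point avoids the colours of its earlier
neighbours, and there are fewer than \<open>N\<close> of them.\<close>

lemma ex_separating_colouring:
  assumes Y: "countable Y" and sym: "\<And>y z. e y z = e z y"
    and N: "\<And>y. y \<in> Y \<Longrightarrow> finite {z\<in>Y. e y z \<le> r} \<and> card {z\<in>Y. e y z \<le> r} < N"
  shows "\<exists>c :: 'a \<Rightarrow> nat. \<forall>y\<in>Y. c y < N \<and> (\<forall>z\<in>Y. z \<noteq> y \<longrightarrow> e y z \<le> (r::real) \<longrightarrow> c y \<noteq> c z)"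
proof -
  define idx where "idx = to_nat_on Y"
  have inj: "inj_on idx Y" unfolding idx_def using Y by (rule inj_on_to_nat_on)
  define nb where "nb y = {z\<in>Y. e y z \<le> r}" for y
  have "\<exists>c. \<forall>y. y \<in> Y \<longrightarrow> c y < N \<and> (\<forall>z\<in>nb y. idx z < idx y \<longrightarrow> c z \<noteq> c y)"
  proof (rule dependent_wf_choice[of "measure idx"
        "\<lambda>c y v. y \<in> Y \<longrightarrow> v < N \<and> (\<forall>z\<in>nb y. idx z < idx y \<longrightarrow> c z \<noteq> v)"])
    fix c :: "'a \<Rightarrow> nat" and y
    show "\<exists>v. y \<in> Y \<longrightarrow> v < N \<and> (\<forall>z\<in>nb y. idx z < idx y \<longrightarrow> c z \<noteq> v)"
    proof (cases "y \<in> Y")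
      case True
      then have "card (c ` nb y) < card {..<N}"
        using N[OF True] card_image_le[of "nb y" c] by (simp add: nb_def)
      then have "\<not> {..<N} \<subseteq> c ` nb y"
        using card_mono[of "c ` nb y" "{..<N}"] N[OF True] by (auto simp: nb_def)
      then show ?thesis by blast
    qed simp
  qed (auto simp: cong: conj_cong)
  then obtain c where c: "\<And>y. y \<in> Y \<Longrightarrow> c y < N"
    "\<And>y z. \<lbrakk>y \<in> Y; z \<in> nb y; idx z < idx y\<rbrakk> \<Longrightarrow> c z \<noteq> c y"
    by blast
  have "c y \<noteq> c z" if "y \<in> Y" "z \<in> Y" "z \<noteq> y" "e y z \<le> r" for y z
  proof -
    have "idx y \<noteq> idx z" using inj that by (auto dest: inj_onD)
    then show ?thesis
      using c(2)[of y z] c(2)[of z y] that sym[of y z] unfolding nb_def by force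
  qed
  then show ?thesis using c(1) by blast
qed

text \<open>A fibration over a base of bounded geometry. The bound on the fibres concerns the fibres over single points;
bounded geometry is what allows them to be glued over bounded subsets of the base.\<close>

theorem asdim_le_fibration:
  assumes MX: "Metric_space X d" and MY: "Metric_space Y e" and f: "f ` X \<subseteq> Y"
    and control: "\<And>D. \<exists>E>0. \<forall>x\<in>X. \<forall>y\<in>X. d x y \<le> D \<longrightarrow> e (f x) (f y) \<le> E"
    and Y: "countable Y"
    and geometry: "\<And>r. \<exists>N. \<forall>y\<in>Y. finite {z\<in>Y. e y z \<le> r} \<and> card {z\<in>Y. e y z \<le> r} < N"
    and base: "asdim_le Y e n"
    and fibres: "\<And>D. 0 < D \<Longrightarrow> \<exists>R. \<forall>y\<in>Y. multi_cover d D R m 1 {x\<in>X. f x = y}"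
  shows "asdim_le X d (n + m)"
proof -
  interpret X: Metric_space X d by fact
  interpret Y: Metric_space Y e by fact
  have "\<exists>R. multi_cover d D R (n + m) 1 X" if D: "0 < D" for D
  proof -
    obtain E where E: "0 < E" "\<And>x y. \<lbrakk>x \<in> X; y \<in> X; d x y \<le> D\<rbrakk> \<Longrightarrow> e (f x) (f y) \<le> E"
      using control by meson
    let ?k = "n + Suc m"
    obtain r where "multi_cover e E r n (Suc m) Y"
      using Y.asdim_le_imp_multi_cover[OF base _ E(1)] by auto
    then obtain Q where Q: "\<And>i. i < ?k \<Longrightarrow> Q i \<subseteq> Y"
      "\<And>i. i < ?k \<Longrightarrow> bounded_components e E r (Q i)"
      "\<And>y. y \<in> Y \<Longrightarrow> Suc m \<le> card {i. i < ?k \<and> y \<in> Q i}"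
      by (rule multi_coverE) (rule that)
    obtain N where N: "\<And>y. y \<in> Y \<Longrightarrow> finite {z\<in>Y. e y z \<le> r} \<and> card {z\<in>Y. e y z \<le> r} < N"
      using geometry[of r] by (elim exE) (rule that, blast)
    obtain c :: "'b \<Rightarrow> nat" where
      c0: "\<forall>y\<in>Y. c y < N \<and> (\<forall>z\<in>Y. z \<noteq> y \<longrightarrow> e y z \<le> r \<longrightarrow> c y \<noteq> c z)"
      using ex_separating_colouring[OF Y Y.commute N] by (rule exE)
    then have c: "\<And>y. y \<in> Y \<Longrightarrow> c y < N"
      "\<And>y z. \<lbrakk>y \<in> Y; z \<in> Y; e y z \<le> r; c y = c z\<rbrakk> \<Longrightarrow> y = z"
      by (simp, metis)
    obtain T where T: "\<And>s y. 0 < s \<Longrightarrow> y \<in> Y \<Longrightarrow> multi_cover d s (T s) m 1 {x\<in>X. f x = y}"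
      using fibres by metis
    \<comment> \<open>\<open>\<rho> j\<close> bounds the \<open>D\<close>-components of what lies over the colours below \<open>j\<close>. The fibres of colour \<open>j\<close> are cut
at the scale \<open>\<rho> j + 2 * D\<close>, as the lemma on unions requires.\<close>
    define \<rho> where "\<rho> = rec_nat D (\<lambda>_ t. max 0 (T (t + 2 * D)) + 2 * t + 2 * D)"
    have \<rho>_Suc: "\<rho> (Suc j) = max 0 (T (\<rho> j + 2 * D)) + 2 * \<rho> j + 2 * D" for j
      by (simp add: \<rho>_def)
    have \<rho>_pos: "0 < \<rho> j" for j
    proof (induction j)
      case 0
      then show ?case using D by (simp add: \<rho>_def)
    next
      case (Suc j)
      then show ?case using D unfolding \<rho>_Suc by (intro add_nonneg_pos) auto
    qed
    let ?s = "\<lambda>y. \<rho> (c y) + 2 * D"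
    have "\<forall>y\<in>Y. \<exists>P. (\<forall>j\<le>m. P j \<subseteq> {x\<in>X. f x = y} \<and> bounded_components d (?s y) (T (?s y)) (P j))
        \<and> (\<forall>x\<in>{x\<in>X. f x = y}. \<exists>j\<le>m. x \<in> P j)"
      unfolding multi_cover_1_iff[symmetric] using T \<rho>_pos D by (simp add: add_pos_pos)
    then obtain P where "\<forall>y\<in>Y. (\<forall>j\<le>m. P y j \<subseteq> {x\<in>X. f x = y} \<and>
        bounded_components d (?s y) (T (?s y)) (P y j)) \<and>
        (\<forall>x\<in>{x\<in>X. f x = y}. \<exists>j\<le>m. x \<in> P y j)"
      unfolding bchoice_iff by (rule exE)
    then have P: "\<And>y j. y \<in> Y \<Longrightarrow> j < Suc m \<Longrightarrow> P y j \<subseteq> {x\<in>X. f x = y}"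
      "\<And>y j. y \<in> Y \<Longrightarrow> j < Suc m \<Longrightarrow> bounded_components d (?s y) (T (?s y)) (P y j)"
      "\<And>x. x \<in> X \<Longrightarrow> f x \<in> Y \<Longrightarrow> \<exists>j<Suc m. x \<in> P (f x) j"
      by (simp_all add: less_Suc_eq_le)
    \<comment> \<open>The fibre over \<open>y\<close> gives its set with number \<open>j\<close> to the index \<open>h y j\<close>.\<close>
    have "\<forall>y\<in>Y. \<exists>h. h ` {..<Suc m} \<subseteq> {i. i < ?k \<and> y \<in> Q i} \<and> inj_on h {..<Suc m}"
      using Q(3) by (intro ballI card_le_inj) auto
    then obtain h where "\<forall>y\<in>Y. h y ` {..<Suc m} \<subseteq> {i. i < ?k \<and> y \<in> Q i} \<and>
        inj_on (h y) {..<Suc m}"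
      unfolding bchoice_iff by (rule exE)
    then have h: "\<And>y. y \<in> Y \<Longrightarrow> h y ` {..<Suc m} \<subseteq> {i. i < ?k \<and> y \<in> Q i}"
      "\<And>y. y \<in> Y \<Longrightarrow> inj_on (h y) {..<Suc m}"
      by simp_all
    define A where "A i = {x\<in>X. \<exists>j<Suc m. h (f x) j = i \<and> x \<in> P (f x) j}" for i
    have A_Q: "f x \<in> Q i" if "x \<in> A i" for x i
      using that h(1)[of "f x"] f unfolding A_def by blast
    \<comment> \<open>Over a set \<open>B\<close> of diameter at most \<open>r\<close>, each colour occurs at most once, so \<open>A i\<close> is a union of single
pieces of fibres, one for each colour.\<close>
    have pieces: "bounded_components d D (\<rho> j) {x\<in>A i. f x \<in> B \<and> c (f x) < j}"
      if B: "B \<subseteq> Y" "\<And>y z. y \<in> B \<Longrightarrow> z \<in> B \<Longrightarrow> e y z \<le> r" for B i j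
    proof (induction j)
      case 0
      then show ?case by (simp add: bounded_components_def)
    next
      case (Suc j)
      let ?V = "{x\<in>A i. f x \<in> B \<and> c (f x) = j}"
      have "bounded_components d (\<rho> j + 2 * D) (max 0 (T (\<rho> j + 2 * D))) ?V"
      proof (cases "?V = {}")
        case False
        then obtain x0 l where x0: "x0 \<in> ?V" "l < Suc m" "h (f x0) l = i"
          unfolding A_def by blast
        then have y0: "f x0 \<in> Y" using B by blast
        have "?V \<subseteq> P (f x0) l"
        proof
          fix x assume x: "x \<in> ?V"
          have x_x0: "f x \<in> B" "f x0 \<in> B" "c (f x) = c (f x0)" using x x0(1) by auto
          then have "f x = f x0" using B by (intro c(2)) auto
          then obtain l' where "l' < Suc m" "h (f x0) l' = i" "x \<in> P (f x0) l'"
            using x unfolding A_def by auto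
          moreover from this have "l' = l"
            using inj_onD[OF h(2)[OF y0], of l' l] x0 by simp
          ultimately show "x \<in> P (f x0) l" by simp
        qed
        moreover have "bounded_components d (\<rho> j + 2 * D) (T (\<rho> j + 2 * D)) (P (f x0) l)"
          using P(2)[OF y0 x0(2)] x0(1) by simp
        ultimately show ?thesis
          by (intro bounded_components_mono[OF bounded_components_subset order_refl max.cobounded2])
      next
        case True
        show ?thesis unfolding True by (simp add: bounded_components_def)
      qed
      then have "bounded_components d D (\<rho> (Suc j)) ({x\<in>A i. f x \<in> B \<and> c (f x) < j} \<union> ?V)"
        unfolding \<rho>_Suc using Suc.IH D \<rho>_pos[of j]
        by (intro X.bounded_components_Un) (auto simp: A_def)
      moreover have "{x\<in>A i. f x \<in> B \<and> c (f x) < j} \<union> ?V = {x\<in>A i. f x \<in> B \<and> c (f x) < Suc j}"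
        by auto
      ultimately show ?case by simp
    qed
    have "bounded_components d D (\<rho> N) (A i)" if i: "i < ?k" for i
    proof -
      \<comment> \<open>A \<open>D\<close>-chain in \<open>A i\<close> is mapped to an \<open>E\<close>-chain in \<open>Q i\<close> and so stays over one component \<open>C y\<close>.\<close>
      define C where "C y = Collect (chained e E (Q i) y)" for y
      have C_sub: "C y \<subseteq> Q i" if "y \<in> Q i" for y
        unfolding C_def using that chained_in by fast
      have C_eq: "C y = C z" if "chained e E (Q i) y z" for y z
        using that Y.chained_sym[OF that] unfolding C_def by (auto intro: rtranclp_trans)
      have C_bd: "e u v \<le> r" if "y \<in> Q i" "u \<in> C y" "v \<in> C y" for y u v
      proof -
        have "u \<in> Q i" using C_sub that by blast
        moreover have "v \<in> C u" using C_eq[of y u] that(2,3) by (simp add: C_def)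
        then have "chained e E (Q i) u v" by (simp add: C_def)
        ultimately show ?thesis by (rule bounded_componentsD[OF Q(2)[OF i]])
      qed
      define W where "W y = {x\<in>A i. f x \<in> C y}" for y
      have W: "bounded_components d D (\<rho> N) (W y)" if "y \<in> Q i" for y
      proof -
        have "W y = {x\<in>A i. f x \<in> C y \<and> c (f x) < N}"
          using c(1) C_sub[OF that] Q(1)[OF i] unfolding W_def by blast
        then show ?thesis
          using pieces[of "C y"] C_sub[OF that] Q(1)[OF i] C_bd[OF that] by simp
      qed
      show ?thesis
      proof (rule bounded_componentsI[where E = "\<lambda>x y. C (f x) = C (f y) \<and>
            chained d D (W (f x)) x y"])
        fix x y z assume g: "x \<in> A i" "y \<in> A i" "z \<in> A i" "d y z \<le> D"
          "C (f x) = C (f y) \<and> chained d D (W (f x)) x y"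
        have "y \<in> X" "z \<in> X" using g(2,3) unfolding A_def by auto
        then have "linked e E (Q i) (f y) (f z)"
          using g(4) E(2) A_Q[OF g(2)] A_Q[OF g(3)] unfolding linked_def by simp
        then have "C (f y) = C (f z)" by (intro C_eq) simp
        moreover from this have "y \<in> W (f x)" "z \<in> W (f x)"
          using g unfolding W_def C_def by auto
        ultimately show "C (f x) = C (f z) \<and> chained d D (W (f x)) x z"
          using g chained_step[of d D _ x y z] by auto
      next
        fix x y assume g: "x \<in> A i" "C (f x) = C (f y) \<and> chained d D (W (f x)) x y"
        moreover have "f x \<in> C (f x)" unfolding C_def by simp
        ultimately have "x \<in> W (f x)" unfolding W_def by simp
        then show "d x y \<le> \<rho> N"
          using bounded_componentsD[OF W[OF A_Q[OF g(1)]], of x y] g(2) by simp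
      qed auto
    qed
    moreover have "\<exists>i\<le>n + m. x \<in> A i" if x: "x \<in> X" for x
    proof -
      have y: "f x \<in> Y" using f x by blast
      obtain j where j: "j < Suc m" "x \<in> P (f x) j" using P(3)[OF x y] by blast
      then have "h (f x) j \<in> h (f x) ` {..<Suc m}" by blast
      then have "h (f x) j < ?k" using h(1)[OF y] by blast
      then show ?thesis
        using x j unfolding A_def by (intro exI[of _ "h (f x) j"]) auto
    qed
    ultimately have "multi_cover d D (\<rho> N) (n + m) 1 X"
      unfolding multi_cover_1_iff by (intro exI[of _ A]) (auto simp: A_def)
    then show ?thesis by blast
  qed
  then show ?thesis using X.asdim_le_iff_multi_cover[of X] by blast
qed

section \<open>Groups with a proper left invariant metric\<close>

text \<open>Every element is a product of a word in the generators and their inverses.\<close>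

lemma (in group) countable_generate:
  assumes "countable S" "S \<subseteq> carrier G"
  shows "countable (generate G S)"
proof -
  define P where "P xs = foldr (\<otimes>) xs \<one>" for xs
  let ?L = "lists (S \<union> (\<lambda>s. inv s) ` S)"
  have carr: "S \<union> (\<lambda>s. inv s) ` S \<subseteq> carrier G" using assms(2) by auto
  have P_closed: "P xs \<in> carrier G" if "xs \<in> ?L" for xs
    using that carr unfolding P_def by (induction rule: lists.induct) auto
  have P_append: "P (xs @ ys) = P xs \<otimes> P ys" if "xs \<in> ?L" "ys \<in> ?L" for xs ys
    using that(1)
  proof (induction rule: lists.induct)
    case Nil
    then show ?case using P_closed[OF that(2)] by (simp add: P_def)
  next
    case (Cons x xs)
    moreover have "x \<in> carrier G" using Cons.hyps(1) carr by blast
    ultimately show ?case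
      using P_closed[OF that(2)] P_closed[of xs] by (simp add: P_def m_assoc)
  qed
  have "g \<in> P ` ?L" if "g \<in> generate G S" for g
    using that
  proof (induction rule: generate.induct)
    case one
    show ?case by (intro image_eqI[of _ _ "[]"]) (simp_all add: P_def)
  next
    case (incl h)
    then show ?case using assms(2) by (intro image_eqI[of _ _ "[h]"]) (auto simp: P_def)
  next
    case (inv h)
    then show ?case using assms(2) by (intro image_eqI[of _ _ "[inv h]"]) (auto simp: P_def)
  next
    case (eng h1 h2)
    then obtain xs ys where "xs \<in> ?L" "P xs = h1" "ys \<in> ?L" "P ys = h2" by blast
    then show ?case
      by (intro image_eqI[of _ _ "xs @ ys"]) (auto simp: P_append)
  qed
  moreover have "countable ?L" using assms(1) by simp
  ultimately show ?thesis by (meson countable_image countable_subset subsetI)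
qed

locale proper_metric_group = group G + Metric_space "carrier G" d
  for G (structure) and d +
  assumes left_invariant:
    "\<lbrakk>g \<in> carrier G; x \<in> carrier G; y \<in> carrier G\<rbrakk> \<Longrightarrow> d (g \<otimes> x) (g \<otimes> y) = d x y"
    and finite_ball: "x \<in> carrier G \<Longrightarrow> finite {y\<in>carrier G. d x y \<le> r}"

lemma proper_metric_group_iff:
  "proper_metric_group G d \<longleftrightarrow> group G \<and> proper_left_invariant_metric G d"
proof -
  have "Metric_space.mcball (carrier G) d x r = {y\<in>carrier G. d x y \<le> r}"
    if "Metric_space (carrier G) d" "x \<in> carrier G" for x r
    using that by (auto simp: Metric_space.in_mcball)
  then show ?thesis
    unfolding proper_metric_group_def proper_metric_group_axioms_def
      proper_left_invariant_metric_def by auto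
qed

context proper_metric_group
begin

lemma dist_one: "x \<in> carrier G \<Longrightarrow> y \<in> carrier G \<Longrightarrow> d \<one> (inv x \<otimes> y) = d x y"
  using left_invariant[of "inv x" x y] by simp

lemma subgroup_metric:
  assumes "subgroup K G"
  shows "proper_left_invariant_metric (G\<lparr>carrier := K\<rparr>) d"
proof -
  have K: "K \<subseteq> carrier G" using assms by (rule subgroup.subset)
  have "finite {y\<in>K. d x y \<le> r}" if "x \<in> K" for x r
    using that K by (intro finite_subset[OF _ finite_ball[of x r]]) auto
  moreover have "Metric_space.mcball K d x r = {y\<in>K. d x y \<le> r}" if "x \<in> K" for x r
    using that by (auto simp: Metric_space.in_mcball[OF subspace[OF K]])
  ultimately show ?thesis
    unfolding proper_left_invariant_metric_def
    using subspace[OF K] left_invariant K by (simp add: subset_iff)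
qed

lemma countable_carrier: "countable (carrier G)"
proof -
  have "carrier G = (\<Union>k::nat. {y\<in>carrier G. d \<one> y \<le> real k})"
    using real_arch_simple by blast
  moreover have "countable (\<Union>k::nat. {y\<in>carrier G. d \<one> y \<le> real k})"
    using finite_ball by (intro countable_UN) (auto intro: countable_finite)
  ultimately show ?thesis by simp
qed

lemma card_ball:
  assumes "x \<in> carrier G"
  shows "card {y\<in>carrier G. d x y \<le> r} \<le> card {y\<in>carrier G. d \<one> y \<le> r}"
proof (rule card_inj_on_le[where f = "\<lambda>y. inv x \<otimes> y"])
  show "inj_on (\<lambda>y. inv x \<otimes> y) {y\<in>carrier G. d x y \<le> r}"
    using assms by (intro inj_onI) simp
qed (use assms dist_one finite_ball in auto)

text \<open>At scale \<open>D\<close>, only elements of length at most \<open>D\<close> matter. They form a finite set \<open>S\<close>, and points of \<open>K\<close> at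
distance at most \<open>D\<close> lie in the same left coset of the subgroup \<open>F\<close> generated by \<open>S\<close>. Thus chains do not
leave a coset, and a cover of \<open>F\<close> is moved to every coset by left translation.\<close>

lemma asdim_le_subgroup:
  assumes K: "subgroup K G"
    and fg: "\<And>S. finite S \<Longrightarrow> S \<subseteq> K \<Longrightarrow> asdim_le (generate G S) d m"
  shows "asdim_le K d m"
proof -
  have KG: "K \<subseteq> carrier G" using K by (rule subgroup.subset)
  interpret K: subgroup K G by fact
  have "\<exists>R. multi_cover d D R m 1 K" if D: "0 < D" for D
  proof -
    define S where "S = {g\<in>K. d \<one> g \<le> D}"
    define F where "F = generate G S"
    have "S \<subseteq> {y\<in>carrier G. d \<one> y \<le> D}" using KG unfolding S_def by auto
    then have "finite S" using finite_ball[OF one_closed] by (rule finite_subset)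
    have S: "S \<subseteq> K" "S \<subseteq> F" unfolding S_def F_def by (auto intro: generate.incl)
    have FK: "F \<subseteq> K" unfolding F_def using S(1) K by (rule generate_subgroup_incl)
    interpret F: subgroup F G
      unfolding F_def using S KG by (intro generate_is_subgroup) blast
    have "asdim_le F d m" unfolding F_def using \<open>finite S\<close> S(1) by (rule fg)
    then obtain R where "multi_cover d D R m 1 F"
      using asdim_le_iff_multi_cover[of F m] FK KG D by blast
    then obtain A where A: "(\<forall>i\<le>m. A i \<subseteq> F \<and> bounded_components d D R (A i)) \<and>
        (\<forall>x\<in>F. \<exists>i\<le>m. x \<in> A i)"
      unfolding multi_cover_1_iff by (rule exE)
    \<comment> \<open>\<open>t\<close> chooses one representative in each left coset of \<open>F\<close>.\<close>
    define t where "t x = (SOME u. u \<in> K \<and> inv u \<otimes> x \<in> F)" for x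
    have t: "t x \<in> K" "inv (t x) \<otimes> x \<in> F" if "x \<in> K" for x
    proof -
      have "x \<in> K \<and> inv x \<otimes> x \<in> F" using that KG by auto
      then have "t x \<in> K \<and> inv (t x) \<otimes> x \<in> F" unfolding t_def by (rule someI)
      then show "t x \<in> K" "inv (t x) \<otimes> x \<in> F" by auto
    qed
    have t_eq: "t y = t z" if "y \<in> K" "z \<in> K" "d y z \<le> D" for y z
    proof -
      have "inv y \<otimes> z \<in> K" using that by simp
      moreover have "d \<one> (inv y \<otimes> z) \<le> D" using that KG by (simp add: dist_one subset_iff)
      ultimately have yz: "inv y \<otimes> z \<in> F" using S(2) unfolding S_def by blast
      have "inv u \<otimes> y \<in> F \<longleftrightarrow> inv u \<otimes> z \<in> F" if u: "u \<in> K" for u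
      proof -
        have c: "u \<in> carrier G" "y \<in> carrier G" "z \<in> carrier G" using u \<open>y \<in> K\<close> \<open>z \<in> K\<close> KG by auto
        have "inv u \<otimes> z = (inv u \<otimes> y) \<otimes> (inv y \<otimes> z)"
          using c by (metis inv_closed m_assoc m_closed r_inv l_one)
        moreover have "inv u \<otimes> y = (inv u \<otimes> z) \<otimes> inv (inv y \<otimes> z)"
          using c by (metis calculation inv_closed inv_solve_right m_closed)
        ultimately show ?thesis using yz F.m_closed F.m_inv_closed by metis
      qed
      then have "(\<lambda>u. u \<in> K \<and> inv u \<otimes> y \<in> F) = (\<lambda>u. u \<in> K \<and> inv u \<otimes> z \<in> F)" by blast
      then show ?thesis unfolding t_def by simp
    qed
    define q where "q x = inv (t x) \<otimes> x" for x
    have q_dist: "d (q x) (q y) = d x y" if "x \<in> K" "y \<in> K" "t x = t y" for x y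
      using left_invariant[of "inv (t y)" x y] t(1)[OF that(2)] that KG
      unfolding q_def by (simp add: subset_iff)
    have q_F: "q x \<in> F" if "x \<in> K" for x unfolding q_def using t(2)[OF that] .
    have "bounded_components d D R {x\<in>K. q x \<in> A i}" if i: "i \<le> m" for i
    proof (rule bounded_componentsI[where E = "\<lambda>x y. t x = t y \<and> chained d D (A i) (q x) (q y)"])
      fix x y z assume h: "x \<in> {x\<in>K. q x \<in> A i}" "y \<in> {x\<in>K. q x \<in> A i}" "z \<in> {x\<in>K. q x \<in> A i}"
        "t x = t y \<and> chained d D (A i) (q x) (q y)" "d y z \<le> D"
      have yz: "t y = t z" using h by (intro t_eq) auto
      then have "d (q y) (q z) \<le> D" using h q_dist[of y z] by simp
      then show "t x = t z \<and> chained d D (A i) (q x) (q z)"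
        using h yz chained_step[of d D "A i" "q x" "q y" "q z"] by simp
    next
      fix x y assume h: "x \<in> {x\<in>K. q x \<in> A i}" "y \<in> {x\<in>K. q x \<in> A i}"
        "t x = t y \<and> chained d D (A i) (q x) (q y)"
      then have "d (q x) (q y) \<le> R"
        using A i by (intro bounded_componentsD[of d D R "A i"]) auto
      then show "d x y \<le> R" using q_dist[of x y] h by simp
    qed simp
    then have "multi_cover d D R m 1 K"
      unfolding multi_cover_1_iff using A q_F
      by (intro exI[of _ "\<lambda>i. {x\<in>K. q x \<in> A i}"]) auto
    then show ?thesis by blast
  qed
  then show ?thesis using asdim_le_iff_multi_cover[OF KG] by blast
qed

end

section \<open>Extensions of groups\<close>

text \<open>Left translation identifies each nonempty fibre isometrically with the kernel. A homomorphism
distorts distances in a controlled way because the elements of length at most \<open>D\<close> are finite in number and have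
finitely many images.\<close>

lemma asdim_le_extension:
  assumes "proper_metric_group G d" "proper_metric_group H e" "group_hom G H f"
    and base: "asdim_le (carrier H) e n" and ker: "asdim_le (kernel G H f) d m"
  shows "asdim_le (carrier G) d (n + m)"
proof -
  interpret G: proper_metric_group G d by fact
  interpret H: proper_metric_group H e by fact
  interpret f: group_hom G H f by fact
  let ?K = "kernel G H f"
  show ?thesis
  proof (rule asdim_le_fibration[where f = f and Y = "carrier H" and e = e])
    show "\<exists>E>0. \<forall>x\<in>carrier G. \<forall>y\<in>carrier G. d x y \<le> D \<longrightarrow> e (f x) (f y) \<le> E" for D
    proof -
      \<comment> \<open>The value 1 is inserted below so that the bound is positive.\<close>
      define V where "V = (\<lambda>g. e \<one>\<^bsub>H\<^esub> (f g)) ` {g\<in>carrier G. d \<one>\<^bsub>G\<^esub> g \<le> D}"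
      have fin: "finite V" unfolding V_def using G.finite_ball by simp
      define E where "E = Max (insert 1 V)"
      have "1 \<le> E" unfolding E_def using fin by simp
      moreover have "e (f x) (f y) \<le> E" if "x \<in> carrier G" "y \<in> carrier G" "d x y \<le> D" for x y
      proof -
        have "e (f x) (f y) = e \<one>\<^bsub>H\<^esub> (f (inv\<^bsub>G\<^esub> x \<otimes>\<^bsub>G\<^esub> y))"
          using that H.dist_one[of "f x" "f y"] by simp
        also have "\<dots> \<in> V"
          unfolding V_def using that G.dist_one[of x y] by (intro imageI) simp
        finally show ?thesis unfolding E_def using fin by simp
      qed
      ultimately show ?thesis by (intro exI[of _ E]) auto
    qed
    show "\<exists>N. \<forall>y\<in>carrier H. finite {z\<in>carrier H. e y z \<le> r} \<and>
        card {z\<in>carrier H. e y z \<le> r} < N" for r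
      using H.finite_ball H.card_ball
      by (intro exI[of _ "Suc (card {z\<in>carrier H. e \<one>\<^bsub>H\<^esub> z \<le> r})"]) (simp add: less_Suc_eq_le)
    show "\<exists>R. \<forall>y\<in>carrier H. multi_cover d D R m 1 {x\<in>carrier G. f x = y}" if "0 < D" for D
    proof -
      have "?K \<subseteq> carrier G" by (auto simp: kernel_def)
      then obtain R where R: "multi_cover d D R m 1 ?K"
        using ker G.asdim_le_iff_multi_cover \<open>0 < D\<close> by blast
      have "multi_cover d D R m 1 {x\<in>carrier G. f x = y}" for y
      proof -
        \<comment> \<open>If the fibre over \<open>y\<close> is empty, then \<open>u\<close> is an arbitrary value and the claims about the translation hold vacuously.\<close>
        define u where "u = (SOME u. u \<in> carrier G \<and> f u = y)"
        have u: "u \<in> carrier G" "f u = y" if "x \<in> carrier G" "f x = y" for x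
          using someI[of "\<lambda>u. u \<in> carrier G \<and> f u = y" x] that unfolding u_def by auto
        have "multi_cover d D (R + 0) m 1 {x\<in>carrier G. f x = y}"
        proof (rule multi_cover_vimage[where q = "\<lambda>x. inv\<^bsub>G\<^esub> u \<otimes>\<^bsub>G\<^esub> x" and e = d and Z = ?K])
          show "multi_cover d (D + 0) R m 1 ?K" using R by simp
          show "(\<lambda>x. inv\<^bsub>G\<^esub> u \<otimes>\<^bsub>G\<^esub> x) ` {x\<in>carrier G. f x = y} \<subseteq> ?K"
            using u by (auto simp: kernel_def)
        next
          fix x x' assume "x \<in> {x\<in>carrier G. f x = y}" "x' \<in> {x\<in>carrier G. f x = y}"
          then show "\<bar>d (inv\<^bsub>G\<^esub> u \<otimes>\<^bsub>G\<^esub> x) (inv\<^bsub>G\<^esub> u \<otimes>\<^bsub>G\<^esub> x') - d x x'\<bar> \<le> 0"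
            using u(1)[of x] G.left_invariant[of "inv\<^bsub>G\<^esub> u" x x'] by simp
        qed
        then show ?thesis by simp
      qed
      then show ?thesis by blast
    qed
  qed (use base G.Metric_space_axioms H.Metric_space_axioms H.countable_carrier in auto)
qed

lemma asdim_group_le_enat_iff:
  "asdim_group G \<le> enat n \<longleftrightarrow>
    (\<forall>F. finitely_generated_subgroup F G \<longrightarrow> asdim_countable_group (G\<lparr>carrier := F\<rparr>) \<le> enat n)"
  unfolding asdim_group_def by (simp add: SUP_le_iff)

theorem theorem2p3:
  fixes G :: "('a, 'c) monoid_scheme" and H :: "('b, 'd) monoid_scheme"
  assumes "group_hom G H \<phi>"
  shows "asdim_group G \<le> asdim_group H + asdim_group (G\<lparr>carrier := kernel G H \<phi>\<rparr>)"
proof (cases "asdim_group H = \<infinity> \<or> asdim_group (G\<lparr>carrier := kernel G H \<phi>\<rparr>) = \<infinity>")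
  case False
  interpret group_hom G H \<phi> by fact
  let ?K = "kernel G H \<phi>"
  obtain n m where n: "asdim_group H = enat n" and m: "asdim_group (G\<lparr>carrier := ?K\<rparr>) = enat m"
    using False by auto
  have "asdim_countable_group (G\<lparr>carrier := F\<rparr>) \<le> enat (n + m)"
    if fg: "finitely_generated_subgroup F G" for F
  proof -
    obtain S where F: "subgroup F G" and S: "finite S" "S \<subseteq> carrier G" "generate G S = F"
      using fg unfolding finitely_generated_subgroup_def by blast
    let ?F = "G\<lparr>carrier := F\<rparr>"
    let ?L = "H\<lparr>carrier := \<phi> ` F\<rparr>"
    have L: "subgroup (\<phi> ` F) H" using F by (rule subgroup_img_is_subgroup)
    have gen_L: "generate H (\<phi> ` S) = \<phi> ` F" using generate_img[OF S(2)] S(3) by simp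
    have groups: "group ?F" "group ?L"
      using F L by (simp_all add: G.subgroup_imp_group H.subgroup_imp_group)
    have "countable F" using G.countable_generate[OF _ S(2)] S(1,3) by (simp add: countable_finite)
    then obtain d where d: "proper_left_invariant_metric ?F d"
      using exists_proper_left_invariant_metric[OF groups(1)] by auto
    obtain e where e: "proper_left_invariant_metric ?L e"
      using exists_proper_left_invariant_metric[OF groups(2)] \<open>countable F\<close> by auto
    interpret F: proper_metric_group ?F d using groups d by (simp add: proper_metric_group_iff)
    interpret L: proper_metric_group ?L e using groups e by (simp add: proper_metric_group_iff)
    have F_sub: "F \<subseteq> carrier G" using F by (rule subgroup.subset)
    interpret \<phi>: group_hom ?F ?L \<phi>
      using groups F_sub by (intro group_hom.intro group_hom_axioms.intro) (auto intro!: homI simp: subset_iff)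
    have "finitely_generated_subgroup (\<phi> ` F) H"
      unfolding finitely_generated_subgroup_def using L gen_L S(1,2) by (intro conjI exI[of _ "\<phi> ` S"]) auto
    then have "asdim_countable_group ?L \<le> enat n"
      using asdim_group_le_enat_iff[of H n] n by simp
    then have base: "asdim_le (carrier ?L) e n"
      unfolding asdim_countable_group_eq[OF groups(2) e] asdim_le_enat_iff .
    have ker_eq: "kernel ?F ?L \<phi> = F \<inter> ?K" using F_sub by (auto simp: kernel_def)
    have "asdim_le (kernel ?F ?L \<phi>) d m"
    proof (rule F.asdim_le_subgroup[OF \<phi>.subgroup_kernel])
      fix S assume S': "finite S" "S \<subseteq> kernel ?F ?L \<phi>"
      then have "S \<subseteq> F" "S \<subseteq> ?K" unfolding ker_eq by auto
      have gen: "generate ?F S = generate G S" using \<open>S \<subseteq> F\<close> F by (rule G.generate_consistent)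
      have "subgroup (generate G S) G" using \<open>S \<subseteq> F\<close> F_sub by (intro G.generate_is_subgroup) auto
      moreover have "generate G S \<subseteq> ?K" using \<open>S \<subseteq> ?K\<close> subgroup_kernel by (rule G.generate_subgroup_incl)
      ultimately have "subgroup (generate G S) (G\<lparr>carrier := ?K\<rparr>)"
        using subgroup_kernel by (intro G.subgroup_incl)
      moreover have "generate (G\<lparr>carrier := ?K\<rparr>) S = generate G S"
        using \<open>S \<subseteq> ?K\<close> subgroup_kernel by (rule G.generate_consistent)
      ultimately have "finitely_generated_subgroup (generate G S) (G\<lparr>carrier := ?K\<rparr>)"
        unfolding finitely_generated_subgroup_def using S'(1) \<open>S \<subseteq> ?K\<close>
        by (intro conjI exI[of _ S]) auto
      then have "asdim_countable_group (G\<lparr>carrier := generate G S\<rparr>) \<le> enat m"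
        using asdim_group_le_enat_iff[of "G\<lparr>carrier := ?K\<rparr>" m] m by fastforce
      moreover have "group (G\<lparr>carrier := generate G S\<rparr>)"
        using \<open>subgroup (generate G S) G\<close> by (rule G.subgroup_imp_group)
      moreover have "proper_left_invariant_metric (G\<lparr>carrier := generate G S\<rparr>) d"
        using F.subgroup_metric[OF F.generate_is_subgroup[of S]] \<open>S \<subseteq> F\<close> gen by simp
      ultimately show "asdim_le (generate ?F S) d m"
        using asdim_countable_group_eq asdim_le_enat_iff gen by fastforce
    qed
    then have "asdim_le (carrier ?F) d (n + m)"
      using asdim_le_extension[OF F.proper_metric_group_axioms L.proper_metric_group_axioms
          \<phi>.group_hom_axioms base] by simp
    then show ?thesis
      unfolding asdim_countable_group_eq[OF groups(1) d] asdim_le_enat_iff .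
  qed
  then have "asdim_group G \<le> enat (n + m)" unfolding asdim_group_le_enat_iff by blast
  then show ?thesis unfolding n m by simp
qed auto

end
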